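(* Suppose that $1\le q<\infty$, $\alpha\in\mathbb{R}\setminus\{0\}$, $\alpha\ne-1+\frac1q$, $\kappa=-\mathrm{sign}(\alpha+1-\frac1q)$, $0<b\le\infty$, $g\in L^q(0,b)$, and let $f\in W^{2,1}_{loc}((0,b))$ be a positive solution of $$f''(x)=g(x)(f(x))^\alpha\quad\text{a.e. on }(0,b),$$ $$\liminf_{R\nearrow b}\kappa|f'(R)|^{2q-2}f'(R)(f(R))^{-q(\alpha+1)+1}-\limsup_{r\searrow 0}\kappa|f'(r)|^{2q-2}f'(r)(f(r))^{-q(\alpha+1)+1}\le 0 .$$ Then: (i) $|f'|^{2q}|f|^{-q(\alpha+1)}\in L^1(0,b)$ and $$\int_0^b|f'(x)|^{2q}|f(x)|^{-q(\alpha+1)}\,dx\le\left(\frac{2q-1}{|q-1+\alpha q|}\right)^q\int_0^b|g(x)|^q\,dx .$$ (ii) With $A_q=\sqrt{2q-1}\,|q-1+\alpha q|^{-\frac12}\left|\frac{1-\alpha}2\right|$, $$\sup\left\{\frac{\left|(f(x))^{\frac{1-\alpha}2}-(f(y))^{\frac{1-\alpha}2}\right|}{|x-y|^{1-\frac1{2q}}}:x,y\in(0,b),\ x\neq y\right\}\le A_q\left(\int_0^b|g(x)|^q\,dx\right)^{\frac1{2q}} .$$ (iii) If $\alpha<1$, then $\lim_{r\searrow 0}f(r)=:f(0)$ exists and, for every $x\in(0,b)$, $$|f(x)|\le\left\{(f(0))^{\frac{1-\alpha}2}+A_q|x|^{1-\frac1{2q}}\left(\int_0^b|g(t)|^q\,dt\right)^{\frac1{2q}}\right\}^{\frac2{1-\alpha}}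 .$$
   Context: Here $f\in W^{2,1}_{loc}$ is identified with its $C^1$ representative whose derivative $f'$ is locally absolutely continuous; "positive" means $f>0$ on $(0,b)$. *)

theory Defs
  imports "HOL-Analysis.Analysis"
begin

text \<open>Classical absolute continuity. A division consists of finitely many nonempty compact
  intervals with pairwise disjoint interiors, and the endpoints of such an interval \<open>K\<close> are
  \<open>Inf K\<close> and \<open>Sup K\<close>. This is unrelated to the library's
  \<open>absolutely_continuous\<close>, which is about measures.\<close>

definition abs_continuous_on :: "real set \<Rightarrow> (real \<Rightarrow> real) \<Rightarrow> bool" where
  "abs_continuous_on S h \<longleftrightarrow>
    (\<forall>\<epsilon>>0. \<exists>\<delta>>0. \<forall>D T. D division_of T \<and> T \<subseteq> S \<and> (\<Sum>K\<in>D. Sup K - Inf K) < \<delta> \<longrightarrow>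
      (\<Sum>K\<in>D. \<bar>h (Sup K) - h (Inf K)\<bar>) < \<epsilon>)"

definition locally_abs_continuous_on :: "real set \<Rightarrow> (real \<Rightarrow> real) \<Rightarrow> bool" where
  "locally_abs_continuous_on I h \<longleftrightarrow> (\<forall>c d. {c..d} \<subseteq> I \<longrightarrow> abs_continuous_on {c..d} h)"

text \<open>Elements of \<open>W\<close>-2-1-loc on an open interval, in the form of their continuously
  differentiable representative.\<close>

definition W21_loc :: "real set \<Rightarrow> (real \<Rightarrow> real) \<Rightarrow> bool" where
  "W21_loc I f \<longleftrightarrow> (\<forall>x\<in>I. f field_differentiable (at x)) \<and> continuous_on I (deriv f) \<and>
    locally_abs_continuous_on I (deriv f)"

definition in_Lq :: "real \<Rightarrow> real set \<Rightarrow> (real \<Rightarrow> real) \<Rightarrow> bool" where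
  "in_Lq q I g \<longleftrightarrow> g \<in> borel_measurable (lebesgue_on I) \<and>
    set_integrable lebesgue I (\<lambda>x. \<bar>g x\<bar> powr q)"

text \<open>Since \<open>b\<close> may be infinite it is an \<^typ>\<open>ereal\<close>, and the lower limit of a function of a real
  variable at \<open>b\<close> is taken along \<open>at_left b\<close> in \<^typ>\<open>ereal\<close>, as the library does for interval
  integrals. Both one-sided limits below are extended reals. On \<^typ>\<open>ereal\<close>, subtracting two equal
  infinities gives \<open>\<infinity>\<close>, so requiring a difference to be \<open>\<le> 0\<close> excludes the cases in which
  the difference is not defined.\<close>

definition liminf_left :: "ereal \<Rightarrow> (real \<Rightarrow> real) \<Rightarrow> ereal" where
  "liminf_left b F = Liminf (at_left b) (\<lambda>R. ereal (F (real_of_ereal R)))"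

definition limsup_right :: "real \<Rightarrow> (real \<Rightarrow> real) \<Rightarrow> ereal" where
  "limsup_right a F = Limsup (at_right a) (\<lambda>r. ereal (F r))"

end

theory Submission
  imports Defs
begin

text \<open>Write \<open>c = q * (\<alpha> + 1) - 1\<close> and \<open>u = \<bar>f'\<bar> powr (2 * q) * f powr (- q * (\<alpha> + 1))\<close>; the hypotheses give
  \<open>c \<noteq> 0\<close> and \<open>\<kappa> = - sgn c\<close>. Differentiating \<open>H = \<kappa> * \<bar>f'\<bar> powr (2 * q - 2) * f' * f powr (- c)\<close>
  and inserting the equation gives, almost everywhere, \<open>\<bar>c\<bar> * u\<close> plus a term of absolute value
  \<open>(2 * q - 1) * \<bar>g\<bar> * u powr (1 - 1 / q)\<close>, where for \<open>q = 1\<close> the last power is read as \<open>1\<close>. The function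
  \<open>H\<close> is locally absolutely continuous, so it is the integral of this derivative
  (\<open>fundamental_theorem_of_calculus_abs_continuous\<close>), and Hoelder's inequality yields on every compact
  interval \<open>{r..R}\<close>, with \<open>V > 0\<close> the integral of \<open>u\<close> over it and \<open>G > 0\<close> a bound for that of
  \<open>\<bar>g\<bar> powr q\<close>,
  \<open>\<bar>c\<bar> * V \<le> H R - H r + (2 * q - 1) * G powr (1 / q) * V powr (1 - 1 / q)\<close>
  (\<open>weighted_energy_increment\<close>).
  The boundary condition makes \<open>H R - H r\<close> at most any prescribed positive number for suitable \<open>r\<close>
  close to \<open>0\<close> and \<open>R\<close> close to \<open>b\<close> (\<open>boundary_increment_small\<close>). As \<open>u \<ge> 0\<close>, the integral of \<open>u\<close>
  over a smaller compact interval is at most \<open>V\<close>, and dividing by \<open>V powr (1 - 1 / q)\<close> bounds it by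
  \<open>((2 * q - 1) / \<bar>c\<bar>) powr q\<close> times the integral of \<open>\<bar>g\<bar> powr q\<close> (\<open>self_improving_bound\<close>). Monotone
  convergence gives (i).

  For (ii), the derivative of \<open>f powr ((1 - \<alpha>) / 2)\<close> has absolute value
  \<open>\<bar>(1 - \<alpha>) / 2\<bar> * u powr (1 / (2 * q))\<close>, and Hoelder's inequality with exponent \<open>2 * q\<close> turns (i) into
  a Hoelder estimate for this power of \<open>f\<close> (\<open>Hoelder_increment_bound\<close>). For (iii), a Hoelder continuous
  function has a limit at the end point \<open>0\<close>, and the estimate passes to it
  (\<open>Hoelder_extends_to_left_endpoint\<close>).

  Hoelder's inequality is used throughout in the form of Young's inequality with free positive
  parameters \<open>G\<close> and \<open>V\<close> (\<open>weighted_Youngs_inequality\<close>), integrated over the interval. As the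
  parameters must be positive, the integral of \<open>\<bar>g\<bar> powr q\<close> is first enlarged by a small positive
  number, which then tends to \<open>0\<close>.\<close>

section \<open>Absolutely continuous functions\<close>

lemma abs_continuous_onE:
  assumes h: "abs_continuous_on S h" and e: "e > 0"
  obtains \<delta> where "\<delta> > 0"
    "\<And>D T. D division_of T \<Longrightarrow> T \<subseteq> S \<Longrightarrow> (\<Sum>K\<in>D. Sup K - Inf K) < \<delta> \<Longrightarrow>
      (\<Sum>K\<in>D. \<bar>h (Sup K) - h (Inf K)\<bar>) < e"
proof -
  from h[unfolded abs_continuous_on_def, THEN spec, THEN mp, OF e]
  obtain \<delta> where \<delta>: "\<delta> > 0 \<and> (\<forall>D T. D division_of T \<and> T \<subseteq> S \<and> (\<Sum>K\<in>D. Sup K - Inf K) < \<delta> \<longrightarrow>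
      (\<Sum>K\<in>D. \<bar>h (Sup K) - h (Inf K)\<bar>) < e)" ..
  show ?thesis
  proof (rule that)
    show "\<delta> > 0" using \<delta> by (rule conjunct1)
    fix D T
    assume "D division_of T" "T \<subseteq> S" "(\<Sum>K\<in>D. Sup K - Inf K) < \<delta>"
    then have "D division_of T \<and> T \<subseteq> S \<and> (\<Sum>K\<in>D. Sup K - Inf K) < \<delta>" by (intro conjI)
    with \<delta>[THEN conjunct2, THEN spec, THEN spec, THEN mp]
    show "(\<Sum>K\<in>D. \<bar>h (Sup K) - h (Inf K)\<bar>) < e" .
  qed
qed

text \<open>An absolutely continuous function is the Henstock--Kurzweil integral of its almost everywhere
  derivative. The gauge is the usual one off the exceptional null set \<open>E\<close>, and lies inside an open set of
  measure less than \<open>\<delta>\<close> at the points of \<open>E\<close>; absolute continuity then bounds the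
  total increment over the intervals tagged in \<open>E\<close>. No integrability of \<open>\<phi>\<close> is assumed.\<close>

lemma fundamental_theorem_of_calculus_abs_continuous:
  fixes h \<phi> :: "real \<Rightarrow> real"
  assumes "a \<le> b" and ac: "abs_continuous_on {a..b} h" and E: "negligible E"
    and der: "\<And>x. x \<in> {a..b} - E \<Longrightarrow> (h has_real_derivative \<phi> x) (at x within {a..b})"
  shows "(\<phi> has_integral (h b - h a)) {a..b}"
proof (cases "a = b")
  case True
  then show ?thesis by auto
next
  case False
  with \<open>a \<le> b\<close> have ab: "a < b" by simp
  define \<phi>0 where "\<phi>0 x = (if x \<in> E then 0 else \<phi> x)" for x
  have "(\<phi>0 has_integral (h b - h a)) {a..b}"
    unfolding has_integral_factor_content_real
  proof (intro allI impI)
    fix e :: real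
    assume e: "e > 0"
    have "\<exists>d>0. x \<in> {a..b} - E \<longrightarrow>
        (\<forall>y\<in>{a..b}. norm (y - x) < d \<longrightarrow> norm (h y - h x - (y - x) *\<^sub>R \<phi> x) \<le> e / 2 * norm (y - x))" for x
    proof (cases "x \<in> {a..b} - E")
      case True
      then have "(h has_vector_derivative \<phi> x) (at x within {a..b})"
        using der by (simp add: has_real_derivative_iff_has_vector_derivative)
      with e show ?thesis
        unfolding has_vector_derivative_def has_derivative_within_alt
        by (metis half_gt_zero)
    next
      case False
      show ?thesis by (rule exI[of _ 1]) (use False in auto)
    qed
    then obtain d where "\<forall>x. d x > 0 \<and> (x \<in> {a..b} - E \<longrightarrow>
        (\<forall>y\<in>{a..b}. norm (y - x) < d x \<longrightarrow> norm (h y - h x - (y - x) *\<^sub>R \<phi> x) \<le> e / 2 * norm (y - x)))"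
      using choice[of "\<lambda>x d. d > 0 \<and> (x \<in> {a..b} - E \<longrightarrow>
        (\<forall>y\<in>{a..b}. norm (y - x) < d \<longrightarrow> norm (h y - h x - (y - x) *\<^sub>R \<phi> x) \<le> e / 2 * norm (y - x)))"]
      by blast
    then have d: "\<And>x. 0 < d x"
      "\<And>x y. \<lbrakk>x \<in> {a..b} - E; y \<in> {a..b}; norm (y - x) < d x\<rbrakk>
          \<Longrightarrow> norm (h y - h x - (y - x) *\<^sub>R \<phi> x) \<le> e / 2 * norm (y - x)"
      by blast+
    obtain \<delta> where \<delta>: "\<delta> > 0"
      and \<delta>D: "\<And>D T. D division_of T \<Longrightarrow> T \<subseteq> {a..b} \<Longrightarrow> (\<Sum>K\<in>D. Sup K - Inf K) < \<delta> \<Longrightarrow>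
        (\<Sum>K\<in>D. \<bar>h (Sup K) - h (Inf K)\<bar>) < e / 2 * (b - a)"
    proof (rule abs_continuous_onE[OF ac])
      show "e / 2 * (b - a) > 0" using e ab by simp
    qed blast
    have E': "E \<in> null_sets lebesgue" using E by (simp add: negligible_iff_null_sets)
    then have "E \<in> sets lebesgue" by auto
    from sets_lebesgue_outer_open[OF this \<delta>]
    obtain U where U: "open U" "E \<subseteq> U" "U - E \<in> lmeasurable" "emeasure lebesgue (U - E) < ennreal \<delta>"
      by blast
    have UE: "U = (U - E) \<union> E" using U by auto
    have Um: "U \<in> lmeasurable" 
      using U(3) E' UE by (metis fmeasurable.Un negligible_iff_measure E)
    have "emeasure lebesgue U < ennreal \<delta>"
      using U(3,4) E' UE emeasure_Un_null_set[of "U - E" lebesgue E] fmeasurableD by metis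
    then have Usmall: "measure lebesgue U < \<delta>"
      using Um \<delta> by (simp add: emeasure_eq_measure2 ennreal_less_iff)
    \<comment> \<open>On \<open>E\<close> the gauge only forces the intervals into \<open>U\<close>.\<close>
    define \<gamma> where "\<gamma> x = (if x \<in> E then U else ball x (d x))" for x
    show "\<exists>\<gamma>. gauge \<gamma> \<and> (\<forall>p. p tagged_division_of {a..b} \<and> \<gamma> fine p \<longrightarrow>
          norm ((\<Sum>(x, K)\<in>p. measure lborel K *\<^sub>R \<phi>0 x) - (h b - h a)) \<le> e * measure lborel {a..b})"
    proof (intro exI conjI allI impI; (elim conjE)?)
      show "gauge \<gamma>" using U d(1) by (auto simp: gauge_def \<gamma>_def)
    next
      fix p
      assume ptag: "p tagged_division_of {a..b}" and finep: "\<gamma> fine p"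
      have ba: "b - a = (\<Sum>(x,K)\<in>p. Sup K - Inf K)" "h b - h a = (\<Sum>(x,K)\<in>p. h (Sup K) - h (Inf K))"
        using additive_tagged_division_1[where f= "\<lambda>x. x"] additive_tagged_division_1[where f= h]
              \<open>a \<le> b\<close> ptag by auto
      define p' where "p' = {z \<in> p. fst z \<in> E}"
      have pfin: "finite p" using ptag by blast
      have p't: "p' tagged_division_of \<Union>(snd ` p')"
      proof (rule tagged_partial_division_of_Union_self)
        show "p' tagged_partial_division_of {a..b}"
          using ptag unfolding tagged_division_of_def p'_def
          by (blast intro: tagged_partial_division_subset)
      qed
      have div: "(snd ` p') division_of \<Union>(snd ` p')"
        by (rule division_of_tagged_division[OF p't])
      have sub: "\<Union>(snd ` p') \<subseteq> {a..b}"
        using ptag unfolding p'_def by fastforce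
      have subU: "\<Union>(snd ` p') \<subseteq> U"
        using finep unfolding fine_def p'_def \<gamma>_def by fastforce
      have "(\<Sum>K\<in>snd ` p'. Sup K - Inf K) = (\<Sum>K\<in>snd ` p'. measure lebesgue K)"
      proof (rule sum.cong[OF refl])
        fix K assume "K \<in> snd ` p'"
        then obtain u v where "K = {u..v}" "u \<le> v" 
          using division_ofD(3,4)[OF div] by (metis atLeastatMost_empty_iff2 box_real(2))
        then show "Sup K - Inf K = measure lebesgue K" by (simp add: measure_completion)
      qed
      also have "\<dots> = measure lebesgue (\<Union>(snd ` p'))"
        using content_division[OF div] by simp
      also have "\<dots> \<le> measure lebesgue U"
        using Um div subU by (intro measure_mono_fmeasurable) (auto intro: lmeasurable_division fmeasurableD)
      also have "\<dots> < \<delta>" by (rule Usmall)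
      finally have "(\<Sum>K\<in>snd ` p'. \<bar>h (Sup K) - h (Inf K)\<bar>) < e / 2 * (b - a)"
        by (intro \<delta>D[OF div sub])
      \<comment> \<open>Two tags may share a degenerate interval, so passing from tagged intervals to intervals needs
        summands that vanish on those; the value at the empty interval is set to \<open>0\<close> for this purpose.\<close>
      moreover have "(\<Sum>(x,K)\<in>p'. \<bar>h (Sup K) - h (Inf K)\<bar>) = (\<Sum>K\<in>snd ` p'. \<bar>h (Sup K) - h (Inf K)\<bar>)"
      proof -
        define w where "w K = (if K = {} then 0 else \<bar>h (Sup K) - h (Inf K)\<bar>)" for K
        have "(\<Sum>(x,K)\<in>p'. w K) = (\<Sum>K\<in>snd ` p'. w K)"
        proof (rule sum.over_tagged_division_lemma[OF p't])
          fix u v :: real assume "box u v = {}"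
          then have "u \<ge> v" by (simp add: box_real)
          then show "w (cbox u v) = 0" by (cases "u = v") (auto simp: w_def)
        qed
        moreover have ne: "K \<noteq> {}" if "(x, K) \<in> p'" for x K
          using that ptag unfolding p'_def by blast
        have "(\<Sum>(x,K)\<in>p'. w K) = (\<Sum>(x,K)\<in>p'. \<bar>h (Sup K) - h (Inf K)\<bar>)"
          by (intro sum.cong refl) (use ne in \<open>auto simp: w_def\<close>)
        moreover have "(\<Sum>K\<in>snd ` p'. w K) = (\<Sum>K\<in>snd ` p'. \<bar>h (Sup K) - h (Inf K)\<bar>)"
          by (intro sum.cong refl) (use ne in \<open>auto simp: w_def\<close>)
        ultimately show ?thesis by simp
      qed
      moreover have "(\<Sum>(x,K)\<in>p'. \<bar>h (Sup K) - h (Inf K)\<bar>) 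
          = (\<Sum>(x,K)\<in>p. if x \<in> E then \<bar>h (Sup K) - h (Inf K)\<bar> else 0)"
        unfolding p'_def using pfin
        by (subst sum.inter_filter) (auto intro!: sum.cong)
      ultimately have small: "(\<Sum>(x,K)\<in>p. if x \<in> E then \<bar>h (Sup K) - h (Inf K)\<bar> else 0) < e / 2 * (b - a)"
        by simp
      have "norm (\<Sum>(x, K) \<in> p. (measure lborel K *\<^sub>R \<phi>0 x) - (h (Sup K) - h (Inf K)))
          \<le> (\<Sum>(x,K)\<in>p. e / 2 * (Sup K - Inf K) + (if x \<in> E then \<bar>h (Sup K) - h (Inf K)\<bar> else 0))"
      proof (rule sum_norm_le, clarify)
        fix x K
        assume xK: "(x, K) \<in> p"
        then have "x \<in> K" and kab: "K \<subseteq> {a..b}"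
          using ptag by blast+
        then obtain u v where k: "K = cbox u v"
          using ptag xK by auto
        have "u \<le> v"
          using \<open>x \<in> K\<close> unfolding k by auto
        have uvK: "u \<in> K" "v \<in> K"
          by (simp_all add: \<open>u \<le> v\<close> k)
        show "norm (measure lborel K *\<^sub>R \<phi>0 x - (h (Sup K) - h (Inf K))) \<le>
          e / 2 * (Sup K - Inf K) + (if x \<in> E then \<bar>h (Sup K) - h (Inf K)\<bar> else 0)"
        proof (cases "x \<in> E")
          case True
          moreover have "0 \<le> e * (v - u) / 2" using \<open>u \<le> v\<close> e by simp
          ultimately show ?thesis
            using \<open>u \<le> v\<close> by (simp add: k \<phi>0_def abs_minus_commute)
        next
          case False
          then have ball: "\<forall>y\<in>K. y \<in> ball x (d x)"
            using finep xK unfolding \<gamma>_def fine_def by fastforce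
          have xab: "x \<in> {a..b} - E" using \<open>x \<in> K\<close> kab False by blast
          have "norm ((v - u) *\<^sub>R \<phi> x - (h v - h u)) 
              = norm (h u - h x - (u - x) *\<^sub>R \<phi> x - (h v - h x - (v - x) *\<^sub>R \<phi> x))"
            by (auto simp: algebra_simps)
          also have "\<dots> \<le> norm (h u - h x - (u - x) *\<^sub>R \<phi> x) + norm (h v - h x - (v - x) *\<^sub>R \<phi> x)"
            by (rule norm_triangle_ineq4)
          also have "\<dots> \<le> e / 2 * norm (u - x) + e / 2 * norm (v - x)"
            using ball uvK kab by (intro add_mono d(2)[OF xab]) (auto simp: dist_real_def)
          also have "\<dots> = e / 2 * (Sup K - Inf K)"
            using \<open>x \<in> K\<close> by (auto simp: k interval_bounds_real[OF \<open>u \<le> v\<close>] field_simps)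
          finally show ?thesis
            using \<open>u \<le> v\<close> False by (simp add: k \<phi>0_def)
        qed
      qed
      also have "\<dots> = e / 2 * (b - a) + (\<Sum>(x,K)\<in>p. if x \<in> E then \<bar>h (Sup K) - h (Inf K)\<bar> else 0)"
        by (simp add: ba(1) split_def sum.distrib sum_distrib_left)
      also have "\<dots> \<le> e * (b - a)" using small by (simp add: field_simps)
      finally show "norm ((\<Sum>(x, K)\<in>p. measure lborel K *\<^sub>R \<phi>0 x) - (h b - h a)) \<le> e * measure lborel {a..b}"
        using \<open>a \<le> b\<close> by (simp add: ba(2) split_def sum_subtractf [symmetric])
    qed
  qed
  then show ?thesis
    by (rule has_integral_spike[OF E, rotated]) (auto simp: \<phi>0_def)
qed

lemma C1_on_interval_imp_Lipschitz:
  fixes f :: "real \<Rightarrow> real"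
  assumes der: "\<And>x. x \<in> {a..b} \<Longrightarrow> (f has_real_derivative f' x) (at x)"
    and cont: "continuous_on {a..b} f'"
  obtains L where "L > 0" "\<And>x y. x \<in> {a..b} \<Longrightarrow> y \<in> {a..b} \<Longrightarrow> \<bar>f x - f y\<bar> \<le> L * \<bar>x - y\<bar>"
proof -
  have "bounded (f' ` {a..b})"
    by (intro compact_imp_bounded compact_continuous_image cont) auto
  then obtain L where L: "L > 0" "\<And>x. x \<in> {a..b} \<Longrightarrow> \<bar>f' x\<bar> \<le> L"
    unfolding bounded_pos by auto
  show ?thesis
  proof (rule that[OF L(1)])
    fix x y assume xy: "x \<in> {a..b}" "y \<in> {a..b}"
    have "norm (f x - f y) \<le> L * norm (x - y)"
      by (rule field_differentiable_bound[of "{a..b}" f f'])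
         (use xy L(2) der in \<open>auto intro: has_field_derivative_at_within\<close>)
    then show "\<bar>f x - f y\<bar> \<le> L * \<bar>x - y\<bar>" by simp
  qed
qed

lemma abs_continuous_on_increment_bound:
  fixes h p :: "real \<Rightarrow> real"
  assumes p: "abs_continuous_on {a..b} p" and K: "K > 0"
    and bound: "\<And>x y. x \<in> {a..b} \<Longrightarrow> y \<in> {a..b} \<Longrightarrow> \<bar>h x - h y\<bar> \<le> K * (\<bar>p x - p y\<bar> + \<bar>x - y\<bar>)"
  shows "abs_continuous_on {a..b} h"
  unfolding abs_continuous_on_def
proof (intro allI impI)
  fix e :: real assume e: "e > 0"
  then have e': "e / (2 * K) > 0" using K by simp
  obtain \<delta> where \<delta>: "\<delta> > 0"
    and \<delta>D: "\<And>D T. D division_of T \<Longrightarrow> T \<subseteq> {a..b} \<Longrightarrow> (\<Sum>k\<in>D. Sup k - Inf k) < \<delta> \<Longrightarrow>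
        (\<Sum>k\<in>D. \<bar>p (Sup k) - p (Inf k)\<bar>) < e / (2 * K)"
    by (rule abs_continuous_onE[OF p e']) blast
  show "\<exists>\<delta>>0. \<forall>D T. D division_of T \<and> T \<subseteq> {a..b} \<and> (\<Sum>k\<in>D. Sup k - Inf k) < \<delta> \<longrightarrow>
      (\<Sum>k\<in>D. \<bar>h (Sup k) - h (Inf k)\<bar>) < e"
  proof (intro exI[of _ "min \<delta> (e / (2 * K))"] conjI allI impI; (elim conjE)?)
    show "0 < min \<delta> (e / (2 * K))" using \<delta> e' by simp
  next
    fix D and T :: "real set"
    assume D: "D division_of T" and T: "T \<subseteq> {a..b}"
      and small: "(\<Sum>k\<in>D. Sup k - Inf k) < min \<delta> (e / (2 * K))"
    have "(\<Sum>k\<in>D. \<bar>h (Sup k) - h (Inf k)\<bar>) \<le> (\<Sum>k\<in>D. K * (\<bar>p (Sup k) - p (Inf k)\<bar> + (Sup k - Inf k)))"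
    proof (rule sum_mono)
      fix k assume k: "k \<in> D"
      obtain u v where uv: "k = cbox u v" "k \<noteq> {}" "k \<subseteq> T"
        using division_ofD(2,3,4)[OF D k] by blast
      then have le: "u \<le> v" by simp
      have "u \<in> k" "v \<in> k" using le by (simp_all add: uv(1))
      then have "u \<in> {a..b}" "v \<in> {a..b}" using uv(3) T by blast+
      from bound[OF this(2) this(1)] show "\<bar>h (Sup k) - h (Inf k)\<bar> \<le> K * (\<bar>p (Sup k) - p (Inf k)\<bar> + (Sup k - Inf k))"
        using le by (simp add: uv(1))
    qed
    also have "\<dots> = K * ((\<Sum>k\<in>D. \<bar>p (Sup k) - p (Inf k)\<bar>) + (\<Sum>k\<in>D. Sup k - Inf k))"
      by (simp only: sum_distrib_left[symmetric] sum.distrib)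
    also have "\<dots> < K * (e / (2 * K) + e / (2 * K))"
      using \<delta>D[OF D T] small K by (intro mult_strict_left_mono add_strict_mono) auto
    also have "\<dots> = e" using K by simp
    finally show "(\<Sum>k\<in>D. \<bar>h (Sup k) - h (Inf k)\<bar>) < e" .
  qed
qed

text \<open>On a compact interval all functions involved are bounded and the continuously differentiable
  ones are Lipschitz, so increments of the product are controlled by those of \<open>p\<close> and of the identity.\<close>

lemma abs_continuous_on_C1_comp_mult:
  fixes p F \<Psi> :: "real \<Rightarrow> real"
  assumes p: "abs_continuous_on {a..b} p" "continuous_on {a..b} p"
    and \<Psi>: "\<And>t. (\<Psi> has_real_derivative \<Psi>' t) (at t)" "continuous_on UNIV \<Psi>'"
    and F: "\<And>x. x \<in> {a..b} \<Longrightarrow> (F has_real_derivative F' x) (at x)" "continuous_on {a..b} F'"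
  shows "abs_continuous_on {a..b} (\<lambda>x. \<Psi> (p x) * F x)"
proof -
  have "bounded (p ` {a..b})"
    by (intro compact_imp_bounded compact_continuous_image p) auto
  then obtain M where "\<forall>x\<in>{a..b}. \<bar>p x\<bar> \<le> M"
    unfolding bounded_iff by auto
  then have M: "\<And>x. x \<in> {a..b} \<Longrightarrow> p x \<in> {-M..M}" by force
  obtain L\<Psi> where L\<Psi>: "L\<Psi> > 0" 
      "\<And>s t. s \<in> {-M..M} \<Longrightarrow> t \<in> {-M..M} \<Longrightarrow> \<bar>\<Psi> s - \<Psi> t\<bar> \<le> L\<Psi> * \<bar>s - t\<bar>"
    using C1_on_interval_imp_Lipschitz[of "-M" M \<Psi> \<Psi>'] \<Psi> by (metis continuous_on_subset subset_UNIV)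
  obtain LF where LF: "LF > 0" "\<And>x y. x \<in> {a..b} \<Longrightarrow> y \<in> {a..b} \<Longrightarrow> \<bar>F x - F y\<bar> \<le> LF * \<bar>x - y\<bar>"
    using C1_on_interval_imp_Lipschitz[of a b F F'] F by blast
  have "continuous_on {a..b} F"
    by (intro continuous_at_imp_continuous_on ballI DERIV_isCont[OF F(1)])
  then have "bounded (F ` {a..b})"
    by (intro compact_imp_bounded compact_continuous_image) auto
  then obtain BF where BF: "BF > 0" "\<And>x. x \<in> {a..b} \<Longrightarrow> \<bar>F x\<bar> \<le> BF"
    unfolding bounded_pos by auto
  have "continuous_on {-M..M} \<Psi>"
    by (intro continuous_at_imp_continuous_on ballI DERIV_isCont[OF \<Psi>(1)])
  then have "bounded (\<Psi> ` {-M..M})"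
    by (intro compact_imp_bounded compact_continuous_image) auto
  then obtain B\<Psi> where B\<Psi>: "B\<Psi> > 0" "\<And>t. t \<in> {-M..M} \<Longrightarrow> \<bar>\<Psi> t\<bar> \<le> B\<Psi>"
    unfolding bounded_pos by auto
  define K where "K = L\<Psi> * BF + B\<Psi> * LF"
  show ?thesis
  proof (rule abs_continuous_on_increment_bound[OF p(1), of K])
    show "K > 0" unfolding K_def using L\<Psi>(1) LF(1) BF(1) B\<Psi>(1) by (simp add: add_pos_pos)
  next
    fix x y assume x: "x \<in> {a..b}" and y: "y \<in> {a..b}"
    have "\<bar>\<Psi> (p x) * F x - \<Psi> (p y) * F y\<bar> = \<bar>(\<Psi> (p x) - \<Psi> (p y)) * F x + \<Psi> (p y) * (F x - F y)\<bar>"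
      by (simp add: algebra_simps)
    also have "\<dots> \<le> \<bar>\<Psi> (p x) - \<Psi> (p y)\<bar> * \<bar>F x\<bar> + \<bar>\<Psi> (p y)\<bar> * \<bar>F x - F y\<bar>"
      by (metis abs_mult abs_triangle_ineq)
    also have "\<dots> \<le> (L\<Psi> * \<bar>p x - p y\<bar>) * BF + B\<Psi> * (LF * \<bar>x - y\<bar>)"
      using L\<Psi> LF(2)[OF x y] BF(2)[OF x] B\<Psi>(2)[OF M[OF y]] M[OF x] M[OF y]
      by (intro add_mono mult_mono) (auto intro: order_trans[OF abs_ge_zero])
    also have "\<dots> \<le> K * (\<bar>p x - p y\<bar> + \<bar>x - y\<bar>)"
    proof -
      have "K * (\<bar>p x - p y\<bar> + \<bar>x - y\<bar>) - ((L\<Psi> * \<bar>p x - p y\<bar>) * BF + B\<Psi> * (LF * \<bar>x - y\<bar>))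
          = L\<Psi> * BF * \<bar>x - y\<bar> + B\<Psi> * LF * \<bar>p x - p y\<bar>"
        unfolding K_def by (simp add: algebra_simps)
      also have "\<dots> \<ge> 0" using L\<Psi>(1) LF(1) BF(1) B\<Psi>(1) by simp
      finally show ?thesis by simp
    qed
    finally show "\<bar>\<Psi> (p x) * F x - \<Psi> (p y) * F y\<bar> \<le> K * (\<bar>p x - p y\<bar> + \<bar>x - y\<bar>)" .
  qed
qed

section \<open>Powers and the inequalities of Young and Hoelder\<close>

text \<open>The case distinction is due to the convention \<open>0 powr 0 = 0\<close>: for \<open>r = 0\<close> the function is the
  identity, with derivative \<open>1\<close> also at \<open>0\<close>.\<close>

lemma has_real_derivative_signed_powr:
  fixes r t :: real
  assumes "0 \<le> r"
  shows "((\<lambda>t. \<bar>t\<bar> powr r * t) has_real_derivative (r + 1) * (if r = 0 then 1 else \<bar>t\<bar> powr r)) (at t)"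
proof (cases "r = 0")
  case True
  have "(\<lambda>t::real. \<bar>t\<bar> powr r * t) = (\<lambda>t. t)" by (auto simp: True)
  then show ?thesis using True by simp
next
  case False
  with assms have r: "r > 0" by simp
  consider "t > 0" | "t < 0" | "t = 0" by linarith
  then show ?thesis
  proof cases
    case 1
    have "((\<lambda>t. t powr (r + 1)) has_real_derivative (r + 1) * t powr r) (at t)"
      using has_real_derivative_powr[OF 1, of "r + 1"] by simp
    then have "((\<lambda>t. \<bar>t\<bar> powr r * t) has_real_derivative (r + 1) * t powr r) (at t)"
      by (rule has_field_derivative_transform_within_open[of _ _ _ "{0<..}"]) (use 1 in \<open>auto simp: powr_add\<close>)
    then show ?thesis using 1 False by simp
  next
    case 2
    have "((\<lambda>t. t powr (r + 1)) has_real_derivative (r + 1) * (-t) powr r) (at (-t))"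
      using has_real_derivative_powr[of "-t" "r + 1"] 2 by simp
    then have "((\<lambda>t. (- t) powr (r + 1)) has_real_derivative (r + 1) * (-t) powr r * (-1)) (at t)"
      by (rule DERIV_chain2) (auto intro!: derivative_eq_intros)
    from DERIV_minus[OF this]
    have "((\<lambda>t. - ((- t) powr (r + 1))) has_real_derivative (r + 1) * (-t) powr r) (at t)"
      by simp
    then have "((\<lambda>t. \<bar>t\<bar> powr r * t) has_real_derivative (r + 1) * (-t) powr r) (at t)"
      by (rule has_field_derivative_transform_within_open[of _ _ _ "{..<0}"]) (use 2 in \<open>auto simp: powr_add\<close>)
    then show ?thesis using 2 False by simp
  next
    case 3
    have "((\<lambda>h::real. \<bar>h\<bar> powr r) \<longlongrightarrow> 0 powr r) (at 0)"
      using r by (intro tendsto_powr' tendsto_rabs_zero tendsto_ident_at tendsto_const) auto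
    then have "((\<lambda>h::real. (\<bar>0 + h\<bar> powr r * (0 + h) - \<bar>0\<bar> powr r * 0) / h) \<longlongrightarrow> 0) (at 0)"
      using r by (auto elim!: Lim_transform_eventually intro!: eventually_at_filter[THEN iffD2] always_eventually)
    then show ?thesis using r by (simp add: 3 DERIV_def)
  qed
qed

lemma continuous_on_signed_powr_derivative:
  fixes r :: real
  assumes "0 \<le> r"
  shows "continuous_on UNIV (\<lambda>t::real. (r + 1) * (if r = 0 then 1 else \<bar>t\<bar> powr r))"
  using assms by (cases "r = 0") (auto intro!: continuous_intros continuous_on_powr')

text \<open>If \<open>a\<close> and \<open>b\<close> are nonnegative functions whose integrals are at most \<open>G\<close> and \<open>V\<close>, then
  integrating this inequality gives Hoelder's inequality, as the last factor integrates to at most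
  \<open>1\<close>.\<close>

lemma weighted_Youngs_inequality:
  fixes a b G V \<theta> :: real
  assumes "0 \<le> a" "0 \<le> b" "0 < G" "0 < V" "0 \<le> \<theta>" "\<theta> \<le> 1"
  shows "a powr \<theta> * b powr (1 - \<theta>) \<le> G powr \<theta> * V powr (1 - \<theta>) * (\<theta> * (a / G) + (1 - \<theta>) * (b / V))"
proof (cases "a = 0 \<or> b = 0")
  case True
  then have "a powr \<theta> * b powr (1 - \<theta>) = 0" by auto
  also have "\<dots> \<le> G powr \<theta> * V powr (1 - \<theta>) * (\<theta> * (a / G) + (1 - \<theta>) * (b / V))"
    using assms by simp
  finally show ?thesis .
next
  case False
  then have ab: "a / G > 0" "b / V > 0" using assms by auto
  have "a powr \<theta> * b powr (1 - \<theta>) = G powr \<theta> * V powr (1 - \<theta>) * ((a / G) powr \<theta> * (b / V) powr (1 - \<theta>))"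
    using assms by (simp add: powr_divide)
  also have "\<dots> \<le> G powr \<theta> * V powr (1 - \<theta>) * (\<theta> * (a / G) + (1 - \<theta>) * (b / V))"
    using assms ab by (intro mult_left_mono Youngs_inequality_0) auto
  finally show ?thesis .
qed

text \<open>Each \<open>e\<close> may have its own \<open>V\<close>. Dividing by \<open>V powr (1 - 1 / q)\<close>, which is at least
  \<open>v powr (1 - 1 / q)\<close>, leaves an inequality in which only \<open>v\<close> remains, so that \<open>e\<close> can tend to
  \<open>0\<close>.\<close>

lemma self_improving_bound:
  fixes c D G v q :: real
  assumes "0 < c" "0 \<le> D" "0 \<le> G" "0 \<le> v" "1 \<le> q"
    and H: "\<And>e. e > 0 \<Longrightarrow> \<exists>V\<ge>v. c * V \<le> e + D * (G + e) powr (1 / q) * V powr (1 - 1 / q)"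
  shows "v \<le> (D / c) powr q * G"
proof (cases "v = 0")
  case True
  then show ?thesis using assms by simp
next
  case False
  with assms have v: "v > 0" by simp
  have "c * v powr (1 / q) \<le> e * v powr (- (1 - 1 / q)) + D * (G + e) powr (1 / q)" if e: "e > 0" for e
  proof -
    obtain V where V: "V \<ge> v" "c * V \<le> e + D * (G + e) powr (1 / q) * V powr (1 - 1 / q)"
      using H[OF e] by blast
    have V0: "V > 0" using V v by simp
    have "c * v powr (1 / q) \<le> c * V powr (1 / q)"
      using assms V v by (intro mult_left_mono powr_mono2) auto
    also have "\<dots> = c * V * V powr (- (1 - 1 / q))"
      using V0 by (simp add: powr_minus powr_diff field_simps)
    also have "\<dots> \<le> (e + D * (G + e) powr (1 / q) * V powr (1 - 1 / q)) * V powr (- (1 - 1 / q))"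
      by (intro mult_right_mono V) auto
    also have "\<dots> = e * V powr (- (1 - 1 / q)) 
        + D * (G + e) powr (1 / q) * (V powr (1 - 1 / q) * V powr (- (1 - 1 / q)))"
      by (simp only: distrib_right mult.assoc)
    also have "V powr (1 - 1 / q) * V powr (- (1 - 1 / q)) = 1"
      using V0 by (simp add: powr_add[symmetric])
    also have "e * V powr (- (1 - 1 / q)) + D * (G + e) powr (1 / q) * 1
        = e * V powr (- (1 - 1 / q)) + D * (G + e) powr (1 / q)"
      by simp
    also have "\<dots> \<le> e * v powr (- (1 - 1 / q)) + D * (G + e) powr (1 / q)"
      using e v V assms by (intro add_right_mono mult_left_mono powr_mono2') auto
    finally show ?thesis .
  qed
  then have ev: "\<forall>\<^sub>F e in at_right 0. c * v powr (1 / q) \<le> e * v powr (- (1 - 1 / q)) + D * (G + e) powr (1 / q)"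
    by (auto simp: eventually_at_filter)
  have "((\<lambda>e. e * v powr (- (1 - 1 / q)) + D * (G + e) powr (1 / q)) \<longlongrightarrow> 0 * v powr (- (1 - 1 / q)) + D * (G + 0) powr (1 / q)) (at_right 0)"
    using assms by (intro tendsto_intros) (auto simp: eventually_at_filter)
  from tendsto_lowerbound[OF this ev] have "c * v powr (1 / q) \<le> D * G powr (1 / q)" by simp
  then have "v powr (1 / q) \<le> (D / c) * G powr (1 / q)"
    using assms(1) by (simp add: field_simps)
  then have "(v powr (1 / q)) powr q \<le> ((D / c) * G powr (1 / q)) powr q"
    using assms by (intro powr_mono2) auto
  moreover have "((D / c) * G powr (1 / q)) powr q = (D / c) powr q * G"
    using assms by (subst powr_mult) (auto simp: powr_powr)
  moreover have "(v powr (1 / q)) powr q = v" using assms by (simp add: powr_powr)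
  ultimately show ?thesis by simp
qed

lemma Hoelder_increment_bound:
  fixes F F' u :: "real \<Rightarrow> real"
  assumes "x < y" and F: "\<And>t. t \<in> {x..y} \<Longrightarrow> (F has_real_derivative F' t) (at t)"
    and F': "\<And>t. t \<in> {x..y} \<Longrightarrow> \<bar>F' t\<bar> \<le> k * u t powr \<theta>"
    and u: "\<And>t. t \<in> {x..y} \<Longrightarrow> 0 \<le> u t" "u integrable_on {x..y}" "integral {x..y} u \<le> B"
    and \<theta>: "0 < \<theta>" "\<theta> \<le> 1" and k: "0 \<le> k" and B: "0 \<le> B"
  shows "\<bar>F y - F x\<bar> \<le> k * B powr \<theta> * (y - x) powr (1 - \<theta>)"
proof -
  have int: "(F' has_integral (F y - F x)) {x..y}"
    using assms(1) F
    by (intro fundamental_theorem_of_calculus)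
       (auto simp: has_real_derivative_iff_has_vector_derivative[symmetric] intro: has_field_derivative_at_within)
  have "\<bar>F y - F x\<bar> \<le> k * (B + e) powr \<theta> * (y - x) powr (1 - \<theta>)" if e: "e > 0" for e
  proof -
    define C where "C = k * ((B + e) powr \<theta> * (y - x) powr (1 - \<theta>))"
    have C: "C \<ge> 0" using k by (simp add: C_def)
    define w where "w t = C * (\<theta> * (u t / (B + e)) + (1 - \<theta>) * (1 / (y - x)))" for t
    have pw: "\<bar>F' t\<bar> \<le> w t" if t: "t \<in> {x..y}" for t
    proof -
      have "\<bar>F' t\<bar> \<le> k * (u t powr \<theta> * 1 powr (1 - \<theta>))" using F'[OF t] by simp
      also have "\<dots> \<le> k * ((B + e) powr \<theta> * (y - x) powr (1 - \<theta>) * (\<theta> * (u t / (B + e)) + (1 - \<theta>) * (1 / (y - x))))"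
        using k u(1)[OF t] B e \<theta> \<open>x < y\<close> by (intro mult_left_mono weighted_Youngs_inequality) auto
      finally show ?thesis by (simp add: w_def C_def)
    qed
    have "((\<lambda>t. u t) has_integral integral {x..y} u) {x..y}" using u(2) by (rule integrable_integral)
    then have "(w has_integral C * (\<theta> * (integral {x..y} u / (B + e)) + (1 - \<theta>) * (1 / (y - x) * (y - x)))) {x..y}"
      unfolding w_def using \<open>x < y\<close>
      by (intro has_integral_mult_right has_integral_add has_integral_divide)
         (auto intro: has_integral_eq_rhs[OF has_integral_const_real])
    then have wint: "(w has_integral C * (\<theta> * (integral {x..y} u / (B + e)) + (1 - \<theta>))) {x..y}"
      using \<open>x < y\<close> by simp
    have "F y - F x \<le> C * (\<theta> * (integral {x..y} u / (B + e)) + (1 - \<theta>))"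
      by (rule has_integral_le[OF int wint]) (use pw in \<open>force simp: abs_le_iff\<close>)
    moreover have "- (F y - F x) \<le> C * (\<theta> * (integral {x..y} u / (B + e)) + (1 - \<theta>))"
      by (rule has_integral_le[OF has_integral_neg[OF int] wint]) (use pw in \<open>force simp: abs_le_iff\<close>)
    moreover have "C * (\<theta> * (integral {x..y} u / (B + e)) + (1 - \<theta>)) \<le> C * (\<theta> * 1 + (1 - \<theta>))"
      using u(3) B e \<theta> C by (intro mult_left_mono add_right_mono) (auto simp: divide_le_eq)
    ultimately show ?thesis by (simp add: C_def abs_le_iff mult.assoc)
  qed
  then have ev: "\<forall>\<^sub>F e in at_right 0. \<bar>F y - F x\<bar> \<le> k * (B + e) powr \<theta> * (y - x) powr (1 - \<theta>)"
    by (auto simp: eventually_at_filter)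
  have "((\<lambda>e. k * (B + e) powr \<theta> * (y - x) powr (1 - \<theta>)) \<longlongrightarrow> k * (B + 0) powr \<theta> * (y - x) powr (1 - \<theta>)) (at_right 0)"
    using B \<theta> by (intro tendsto_intros) (auto simp: eventually_at_filter)
  from tendsto_lowerbound[OF this ev] show ?thesis by simp
qed

section \<open>Behaviour at the end points\<close>

text \<open>As \<open>\<infinity> - \<infinity>\<close> equals \<open>\<infinity>\<close> on the extended reals, the hypothesis excludes a lower limit
  \<open>\<infinity>\<close> at \<open>b\<close> and an upper limit \<open>-\<infinity>\<close> at \<open>0\<close>. In the remaining cases a real \<open>M\<close> separates the two
  limits up to \<open>e\<close>.\<close>

lemma boundary_increment_small:
  fixes \<Phi> :: "real \<Rightarrow> real" and b :: ereal
  assumes lim: "liminf_left b \<Phi> - limsup_right 0 \<Phi> \<le> 0"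
    and cd: "0 < c" "ereal d < b" and e: "0 < e"
  obtains r R where "0 < r" "r \<le> c" "d \<le> R" "ereal R < b" "\<Phi> R - \<Phi> r \<le> e"
proof -
  obtain M where M: "liminf_left b \<Phi> < ereal (M + e)" "ereal M < limsup_right 0 \<Phi>"
  proof (cases "liminf_left b \<Phi>"; cases "limsup_right 0 \<Phi>")
    fix s t assume "liminf_left b \<Phi> = ereal s" "limsup_right 0 \<Phi> = ereal t"
    then show ?thesis using lim e that[of "s - e / 2"] by simp
  next
    fix s assume "liminf_left b \<Phi> = ereal s" "limsup_right 0 \<Phi> = \<infinity>"
    then show ?thesis using e that[of s] by simp
  next
    fix t assume "liminf_left b \<Phi> = - \<infinity>" "limsup_right 0 \<Phi> = ereal t"
    then show ?thesis using e that[of "t - 1"] by simp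
  next
    assume "liminf_left b \<Phi> = - \<infinity>" "limsup_right 0 \<Phi> = \<infinity>"
    then show ?thesis using that[of 0] by simp
  qed (use lim in auto)
  have "\<exists>\<^sub>F R in at_left b. ereal (\<Phi> (real_of_ereal R)) < ereal (M + e)"
  proof (rule ccontr)
    assume "\<not> ?thesis"
    then have "\<forall>\<^sub>F R in at_left b. ereal (M + e) \<le> ereal (\<Phi> (real_of_ereal R))"
      by (simp add: not_frequently not_less)
    from Liminf_bounded[OF this] M(1) show False by (simp add: liminf_left_def)
  qed
  moreover have "\<forall>\<^sub>F R in at_left b. ereal d < R \<and> R < b"
    using cd(2) by (auto simp: eventually_at_left[OF cd(2)])
  ultimately have "\<exists>\<^sub>F R in at_left b. ereal (\<Phi> (real_of_ereal R)) < ereal (M + e) \<and> (ereal d < R \<and> R < b)"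
    by (rule frequently_eventually_frequently)
  then obtain R' where R': "ereal (\<Phi> (real_of_ereal R')) < ereal (M + e)" "ereal d < R'" "R' < b"
    using frequently_ex by blast
  define R where "R = real_of_ereal R'"
  have R: "R' = ereal R" using R'(2,3) unfolding R_def by (cases R') auto
  have "\<exists>\<^sub>F r in at_right 0. ereal M < ereal (\<Phi> r)"
  proof (rule ccontr)
    assume "\<not> ?thesis"
    then have "\<forall>\<^sub>F r in at_right 0. ereal (\<Phi> r) \<le> ereal M"
      by (simp add: not_frequently not_less)
    from Limsup_bounded[OF this] M(2) show False by (simp add: limsup_right_def)
  qed
  moreover have "\<forall>\<^sub>F r in at_right 0. r \<in> {0<..<c}"
    by (rule eventually_at_right_real) (rule cd)
  ultimately have "\<exists>\<^sub>F r in at_right 0. ereal M < ereal (\<Phi> r) \<and> r \<in> {0<..<c}"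
    by (rule frequently_eventually_frequently)
  then obtain r where r: "M < \<Phi> r" "0 < r" "r < c"
    using frequently_ex by fastforce
  show ?thesis
    by (rule that[of r R]) (use r R' R in auto)
qed

lemma Hoelder_extends_to_left_endpoint:
  fixes F :: "real \<Rightarrow> real" and b :: ereal
  assumes b: "0 < b" and s0: "0 < s"
    and holder: "\<And>x y. x \<in> einterval 0 b \<Longrightarrow> y \<in> einterval 0 b \<Longrightarrow> \<bar>F x - F y\<bar> \<le> E * \<bar>x - y\<bar> powr s"
  obtains l where "(F \<longlongrightarrow> l) (at_right 0)" "\<And>x. x \<in> einterval 0 b \<Longrightarrow> F x \<le> l + E * \<bar>x\<bar> powr s"
    "\<forall>\<^sub>F x in at_right 0. x \<in> einterval 0 b"
proof -
  define I where "I = einterval 0 b"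
  note holder = holder[folded I_def]
  obtain d where d: "0 < d" "{0<..<d} \<subseteq> I"
  proof -
    obtain z where z: "0 < z" "z < b" using dense[OF b] by blast
    then obtain d where "z = ereal d" "0 < d" by (cases z) auto
    have "t \<in> I" if "t \<in> {0<..<d}" for t
      using that less_trans[of "ereal t" "ereal d" b] z(2) \<open>z = ereal d\<close>
      by (simp add: I_def einterval_iff)
    then show ?thesis using that[of d] \<open>0 < d\<close> by blast
  qed
  have uc: "uniformly_continuous_on {0<..<d} F"
    unfolding uniformly_continuous_on_def
  proof (intro allI impI)
    fix e :: real assume e: "e > 0"
    have "((\<lambda>t. E * \<bar>t\<bar> powr s) \<longlongrightarrow> E * \<bar>0\<bar> powr s) (at (0::real))"
      using s0 by (intro tendsto_intros) auto
    then have "\<forall>\<^sub>F t in at 0. E * \<bar>t\<bar> powr s < e"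
      using e by (intro order_tendstoD(2)) auto
    then obtain \<delta> where \<delta>: "\<delta> > 0" "\<And>t. t \<noteq> 0 \<Longrightarrow> \<bar>t\<bar> < \<delta> \<Longrightarrow> E * \<bar>t\<bar> powr s < e"
      by (auto simp: eventually_at dist_real_def)
    show "\<exists>\<delta>>0. \<forall>x\<in>{0<..<d}. \<forall>x'\<in>{0<..<d}. dist x' x < \<delta> \<longrightarrow> dist (F x') (F x) < e"
    proof (intro exI[of _ \<delta>] conjI \<delta>(1) ballI impI)
      fix x x' assume x: "x \<in> {0<..<d}" "x' \<in> {0<..<d}" "dist x' x < \<delta>"
      show "dist (F x') (F x) < e"
      proof (cases "x' = x")
        case False
        then show ?thesis
          using holder[of x' x] \<delta>(2)[of "x' - x"] x d(2) by (force simp: dist_real_def)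
      qed (use e in auto)
    qed
  qed
  have right: "at 0 within {0<..<d} = at_right 0"
    by (rule at_within_nhd[of 0 "{..<d}"]) (use d(1) in auto)
  have closure0: "0 \<in> closure {0<..<d}" using d(1) by simp
  obtain l where "(F \<longlongrightarrow> l) (at 0 within {0<..<d})"
    by (rule uniformly_continuous_on_extension_at_closure[OF uc closure0])
  then have l: "(F \<longlongrightarrow> l) (at_right 0)"
    by (simp add: right)
  have evI: "\<forall>\<^sub>F x in at_right 0. x \<in> I"
    by (rule eventually_mono[OF eventually_at_right_real[OF d(1)]]) (use d(2) in auto)
  have "F x \<le> l + E * \<bar>x\<bar> powr s" if x: "x \<in> I" for x
  proof -
    have "((\<lambda>y. F y + E * \<bar>x - y\<bar> powr s) \<longlongrightarrow> l + E * \<bar>x - 0\<bar> powr s) (at_right 0)"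
      using s0 by (intro tendsto_intros l) auto
    moreover have "\<forall>\<^sub>F y in at_right 0. F x \<le> F y + E * \<bar>x - y\<bar> powr s"
      using evI by eventually_elim (use holder[OF x] in \<open>force simp: abs_le_iff\<close>)
    ultimately show ?thesis using tendsto_lowerbound by fastforce
  qed
  with l evI show ?thesis using that[of l] by (simp add: I_def)
qed

lemma atLeastAtMost_subset_einterval:
  assumes "x \<in> einterval a b" "y \<in> einterval a b"
  shows "{x..y} \<subseteq> einterval a b"
proof
  fix t assume "t \<in> {x..y}"
  then have "ereal x \<le> ereal t" "ereal t \<le> ereal y" by auto
  with assms show "t \<in> einterval a b"
    unfolding einterval_iff by (blast intro: less_le_trans le_less_trans)
qed

lemma set_integrable_einterval_nonneg_bounded:
  fixes a b :: ereal and u :: "real \<Rightarrow> real"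
  assumes ab: "a < b" and cont: "continuous_on (einterval a b) u"
    and nonneg: "\<And>x. x \<in> einterval a b \<Longrightarrow> 0 \<le> u x"
    and bound: "\<And>x y. x \<in> einterval a b \<Longrightarrow> y \<in> einterval a b \<Longrightarrow> x < y \<Longrightarrow> integral {x..y} u \<le> B"
  shows "set_integrable lebesgue (einterval a b) u" "(LINT x:einterval a b|lebesgue. u x) \<le> B"
proof -
  obtain v l :: "nat \<Rightarrow> real" where approx: "einterval a b = (\<Union>i. {l i..v i})"
    "incseq v" "decseq l" "\<And>i. l i < v i" "\<And>i. a < l i" "\<And>i. v i < b"
    "l \<longlonglongrightarrow> a" "v \<longlonglongrightarrow> b"
  proof (rule einterval_Icc_approximation[OF ab])
  qed (rule that)
  have sub: "{l i..v i} \<subseteq> einterval a b" for i using approx(1) by auto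
  have mem: "l i \<in> einterval a b" "v i \<in> einterval a b" for i
    using sub[of i] approx(4)[of i] by auto
  have int: "set_integrable lborel {l i..v i} u" for i
    by (rule borel_integrable_atLeastAtMost') (rule continuous_on_subset[OF cont sub])
  have I: "u integrable_on {l i..v i}" for i
    by (rule integrable_continuous_real) (rule continuous_on_subset[OF cont sub])
  have eq: "(LBINT x=l i..v i. u x) = integral {l i..v i} u" for i
    using interval_integral_eq_integral[of "l i" "v i" u] int approx(4)[of i] by simp
  have "incseq (\<lambda>i. integral {l i..v i} u)"
  proof (rule incseq_SucI)
    fix i
    have "l (Suc i) \<le> l i" "v i \<le> v (Suc i)"
      using approx(2,3) by (auto simp: incseq_Suc_iff decseq_Suc_iff)
    then show "integral {l i..v i} u \<le> integral {l (Suc i)..v (Suc i)} u"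
      using sub[of "Suc i"] by (intro integral_subset_le I) (auto intro: nonneg)
  qed
  moreover have le: "integral {l i..v i} u \<le> B" for i
    by (rule bound) (use mem approx(4) in auto)
  ultimately obtain C where C: "(\<lambda>i. integral {l i..v i} u) \<longlonglongrightarrow> C"
    using incseq_convergent[of "\<lambda>i. integral {l i..v i} u" B] by blast
  have CB: "C \<le> B" using C le by (intro LIMSEQ_le_const2[OF C]) auto
  have meas: "set_borel_measurable lborel (einterval a b) u"
    using borel_measurable_continuous_on_indicator[OF borel_einterval cont]
    by (simp add: set_borel_measurable_def)
  have lim: "(\<lambda>i. LBINT x=l i..v i. u x) \<longlonglongrightarrow> C" using C eq by simp
  have ae: "AE x in lborel. a < ereal x \<longrightarrow> ereal x < b \<longrightarrow> 0 \<le> u x"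
    using nonneg by (auto simp: einterval_iff)
  note R = interval_integral_Icc_approx_nonneg[OF ab approx int ae meas lim]
  show leb: "set_integrable lebesgue (einterval a b) u"
    using R(1) meas unfolding set_integrable_def set_borel_measurable_def
    by (subst integrable_completion) auto
  have "(LINT x:einterval a b|lebesgue. u x) = integral (einterval a b) u"
    by (rule set_lebesgue_integral_eq_integral(2)[OF leb])
  also have "\<dots> = (LBINT x=a..b. u x)"
    using interval_integral_eq_integral'[OF less_imp_le[OF ab] R(1)] by simp
  also have "\<dots> = C" by (rule R(2))
  finally show "(LINT x:einterval a b|lebesgue. u x) \<le> B" using CB by simp
qed

section \<open>The energy inequality\<close>

text \<open>The inequality between \<open>\<integral> u\<close> and the increment of \<open>H\<close> on a compact interval. Here \<open>p\<close> stands for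
  \<open>f'\<close>, and \<open>N\<close> is the null set off which the differential equation holds.\<close>

lemma weighted_energy_increment:
  fixes f p g :: "real \<Rightarrow> real" and q \<alpha> c G r R :: real
  defines "u \<equiv> (\<lambda>x. \<bar>p x\<bar> powr (2 * q) * f x powr (- q * (\<alpha> + 1)))"
    and "H \<equiv> (\<lambda>x. - sgn c * \<bar>p x\<bar> powr (2 * q - 2) * p x * f x powr (- q * (\<alpha> + 1) + 1))"
  defines "V \<equiv> integral {r..R} u"
  assumes q: "1 \<le> q" and c: "c = q * (\<alpha> + 1) - 1" and rR: "r \<le> R"
    and f: "\<And>x. x \<in> {r..R} \<Longrightarrow> (f has_real_derivative p x) (at x)"
    and pos: "\<And>x. x \<in> {r..R} \<Longrightarrow> 0 < f x"
    and p: "continuous_on {r..R} p" "abs_continuous_on {r..R} p"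
    and N: "negligible N"
    and ode: "\<And>x. x \<in> {r..R} - N \<Longrightarrow> (p has_real_derivative g x * f x powr \<alpha>) (at x)"
    and g: "(\<lambda>x. \<bar>g x\<bar> powr q) integrable_on {r..R}" "integral {r..R} (\<lambda>x. \<bar>g x\<bar> powr q) \<le> G"
    and G: "0 < G" and V: "0 < V"
  shows "\<bar>c\<bar> * V \<le> H R - H r + (2 * q - 1) * G powr (1 / q) * V powr (1 - 1 / q)"
proof -
  define \<Psi>' where "\<Psi>' t = (2 * q - 1) * (if 2 * q - 2 = 0 then 1 else \<bar>t\<bar> powr (2 * q - 2))" for t :: real
  define F where "F x = - sgn c * f x powr (- c)" for x
  define F' where "F' x = - sgn c * (- c * f x powr (- c - 1) * p x)" for x
  have \<Psi>: "((\<lambda>t. \<bar>t\<bar> powr (2 * q - 2) * t) has_real_derivative \<Psi>' t) (at t)" for t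
    using has_real_derivative_signed_powr[of "2 * q - 2" t] q by (simp add: \<Psi>'_def)
  have \<Psi>'cont: "continuous_on UNIV \<Psi>'"
    using continuous_on_signed_powr_derivative[of "2 * q - 2"] q by (simp add: \<Psi>'_def[abs_def])
  have F: "(F has_real_derivative F' x) (at x)" if "x \<in> {r..R}" for x
    unfolding F_def[abs_def] F'_def
    by (rule DERIV_cmult)
       (rule DERIV_chain2[OF has_real_derivative_powr f], use pos that in auto)
  have fcont: "continuous_on {r..R} f"
    by (intro continuous_at_imp_continuous_on ballI DERIV_isCont[OF f])
  have fpcont: "continuous_on {r..R} (\<lambda>x. f x powr s)" for s
    using pos by (intro continuous_on_powr fcont continuous_on_const) force
  have F'cont: "continuous_on {r..R} F'"
    unfolding F'_def[abs_def] by (intro continuous_intros fpcont p)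
  have Heq: "H = (\<lambda>x. (\<bar>p x\<bar> powr (2 * q - 2) * p x) * F x)"
    by (auto simp: H_def F_def c algebra_simps)
  have Hac: "abs_continuous_on {r..R} H"
    unfolding Heq by (rule abs_continuous_on_C1_comp_mult[OF p(2,1) \<Psi> \<Psi>'cont F F'cont])
  define \<phi> where "\<phi> x = \<Psi>' (p x) * (g x * f x powr \<alpha>) * F x + F' x * (\<bar>p x\<bar> powr (2 * q - 2) * p x)" for x
  have Hint: "(\<phi> has_integral (H R - H r)) {r..R}"
  proof (rule fundamental_theorem_of_calculus_abs_continuous[OF rR Hac N])
    fix x assume x: "x \<in> {r..R} - N"
    then have x': "x \<in> {r..R}" by blast
    have "(H has_real_derivative \<phi> x) (at x)"
      unfolding Heq \<phi>_def
      by (rule DERIV_mult[OF DERIV_chain2[OF \<Psi> ode[OF x]] F[OF x']])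
    then show "(H has_real_derivative \<phi> x) (at x within {r..R})"
      by (rule has_field_derivative_at_within)
  qed
  have ucont: "continuous_on {r..R} u"
    unfolding u_def using q
    by (intro continuous_on_mult fpcont continuous_on_powr' continuous_intros p) auto
  have uint: "(u has_integral V) {r..R}"
    unfolding V_def using ucont by (intro integrable_integral integrable_continuous_real)
  define D where "D = (2 * q - 1) * (G powr (1 / q) * V powr (1 - 1 / q))"
  have D: "0 \<le> D" using q by (simp add: D_def)
  define w where "w x = D * (1 / q * (\<bar>g x\<bar> powr q / G) + (1 - 1 / q) * (u x / V))" for x
  have wint: "(w has_integral D * (1 / q * (integral {r..R} (\<lambda>x. \<bar>g x\<bar> powr q) / G) + (1 - 1 / q) * (V / V))) {r..R}"
    unfolding w_def[abs_def]
    by (intro has_integral_mult_right has_integral_add has_integral_divide uint integrable_integral g)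
  have young: "\<bar>\<Psi>' (p x) * (g x * f x powr \<alpha>) * F x\<bar> \<le> w x" if x: "x \<in> {r..R}" for x
  proof -
    have f0: "0 < f x" using pos x by blast
    have ff: "f x powr \<alpha> * f x powr (- c) = f x powr (- (q - 1) * (\<alpha> + 1))"
      unfolding powr_add[symmetric] by (simp add: c algebra_simps)
    \<comment> \<open>For \<open>q = 1\<close> the factor \<open>u powr (1 - 1 / q)\<close> would be \<open>0\<close> where \<open>p\<close> vanishes, so this case is
      treated separately; there \<open>c = \<alpha>\<close> and the powers of \<open>f\<close> cancel.\<close>
    have "\<bar>\<Psi>' (p x) * (g x * f x powr \<alpha>) * F x\<bar>
        = \<bar>sgn c\<bar> * \<bar>\<Psi>' (p x)\<bar> * \<bar>g x\<bar> * (f x powr \<alpha> * f x powr (- c))"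
      by (simp add: F_def abs_mult)
    also have "\<dots> \<le> \<bar>\<Psi>' (p x)\<bar> * \<bar>g x\<bar> * (f x powr \<alpha> * f x powr (- c))"
      by (simp add: abs_sgn_eq)
    also have "\<dots> \<le> w x"
    proof (cases "q = 1")
      case True
      then show ?thesis using G V f0 by (simp add: w_def D_def ff \<Psi>'_def)
    next
      case False
      with q have q1: "q > 1" by simp
      have "u x powr (1 - 1 / q) = \<bar>p x\<bar> powr (2 * q * (1 - 1 / q)) * f x powr (- q * (\<alpha> + 1) * (1 - 1 / q))"
        by (simp add: u_def powr_mult powr_powr)
      also have "2 * q * (1 - 1 / q) = 2 * q - 2" using q1 by (simp add: field_simps)
      also have "- q * (\<alpha> + 1) * (1 - 1 / q) = - (q - 1) * (\<alpha> + 1)" using q1 by (simp add: field_simps)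
      finally have u: "u x powr (1 - 1 / q) = \<bar>p x\<bar> powr (2 * q - 2) * f x powr (- (q - 1) * (\<alpha> + 1))" .
      have "\<bar>\<Psi>' (p x)\<bar> * \<bar>g x\<bar> * (f x powr \<alpha> * f x powr (- c))
          = (2 * q - 1) * ((\<bar>g x\<bar> powr q) powr (1 / q) * u x powr (1 - 1 / q))"
        unfolding ff u using q1 by (simp add: \<Psi>'_def powr_powr abs_mult)
      also have "\<dots> \<le> (2 * q - 1) * (G powr (1 / q) * V powr (1 - 1 / q) *
          (1 / q * (\<bar>g x\<bar> powr q / G) + (1 - 1 / q) * (u x / V)))"
        using q1 G V by (intro mult_left_mono weighted_Youngs_inequality) (auto simp: u_def)
      also have "\<dots> = w x" by (simp add: w_def D_def)
      finally show ?thesis .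
    qed
    finally show ?thesis .
  qed
  have energy: "F' x * (\<bar>p x\<bar> powr (2 * q - 2) * p x) = \<bar>c\<bar> * u x" if x: "x \<in> {r..R}" for x
  proof -
    have "\<bar>p x\<bar> powr (2 * q - 2) * (p x * p x) = \<bar>p x\<bar> powr (2 * q)"
    proof (cases "p x = 0")
      case False
      then have "\<bar>p x\<bar> powr (2 * q) = \<bar>p x\<bar> powr (2 * q - 2) * \<bar>p x\<bar> powr 2"
        by (simp only: powr_add[symmetric]) simp
      then show ?thesis using False by (simp add: power2_eq_square)
    qed simp
    then have *: "\<bar>p x\<bar> powr (2 * q - 2) * p x * p x = \<bar>p x\<bar> powr (2 * q)" by (simp add: mult.assoc)
    have "F' x * (\<bar>p x\<bar> powr (2 * q - 2) * p x) = (sgn c * c) * (\<bar>p x\<bar> powr (2 * q - 2) * p x * p x) * f x powr (- c - 1)"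
      by (simp add: F'_def)
    also have "\<dots> = \<bar>c\<bar> * (\<bar>p x\<bar> powr (2 * q)) * f x powr (- c - 1)"
      unfolding * by (simp add: abs_sgn mult.commute)
    also have "- c - 1 = - q * (\<alpha> + 1)" by (simp add: c)
    finally show ?thesis by (simp add: u_def)
  qed
  have "\<bar>c\<bar> * V - D * (1 / q * (integral {r..R} (\<lambda>x. \<bar>g x\<bar> powr q) / G) + (1 - 1 / q) * (V / V)) \<le> H R - H r"
  proof (rule has_integral_le[OF has_integral_diff[OF has_integral_mult_right[OF uint] wint] Hint])
    fix x assume x: "x \<in> {r..R}"
    show "\<bar>c\<bar> * u x - w x \<le> \<phi> x"
      unfolding \<phi>_def energy[OF x] using young[OF x] by linarith
  qed
  moreover have "D * (1 / q * (integral {r..R} (\<lambda>x. \<bar>g x\<bar> powr q) / G) + (1 - 1 / q) * (V / V))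
      \<le> D * (1 / q * 1 + (1 - 1 / q) * 1)"
    using D g(2) G V q by (intro mult_left_mono add_mono) (auto simp: divide_le_eq)
  ultimately show ?thesis by (simp add: D_def)
qed

section \<open>Weighted integral and pointwise bounds\<close>

theorem proposition7p2:
  fixes q \<alpha> \<kappa> A :: real and b :: ereal and f g :: "real \<Rightarrow> real" and I :: "real set"
  assumes q: "1 \<le> q"
    and \<alpha>: "\<alpha> \<noteq> 0" "\<alpha> \<noteq> -1 + 1 / q"
    and \<kappa>: "\<kappa> = - sgn (\<alpha> + 1 - 1 / q)"
    and b: "0 < b"
    and I: "I = einterval 0 b"
    and g: "in_Lq q I g"
    and f: "W21_loc I f"
    and f_pos: "\<forall>x\<in>I. 0 < f x"
    and ode: "AE x in lebesgue. x \<in> I \<longrightarrow>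
               (deriv f has_real_derivative g x * f x powr \<alpha>) (at x)"
    and boundary:
      "liminf_left b (\<lambda>R. \<kappa> * \<bar>deriv f R\<bar> powr (2 * q - 2) * deriv f R * f R powr (- q * (\<alpha> + 1) + 1))
       - limsup_right 0 (\<lambda>r. \<kappa> * \<bar>deriv f r\<bar> powr (2 * q - 2) * deriv f r * f r powr (- q * (\<alpha> + 1) + 1))
       \<le> 0"
    and A: "A = sqrt (2 * q - 1) * \<bar>q - 1 + \<alpha> * q\<bar> powr (- 1 / 2) * \<bar>(1 - \<alpha>) / 2\<bar>"
  shows
    "(set_integrable lebesgue I (\<lambda>x. \<bar>deriv f x\<bar> powr (2 * q) * \<bar>f x\<bar> powr (- q * (\<alpha> + 1))) \<and>
      (LINT x:I|lebesgue. \<bar>deriv f x\<bar> powr (2 * q) * \<bar>f x\<bar> powr (- q * (\<alpha> + 1)))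
        \<le> ((2 * q - 1) / \<bar>q - 1 + \<alpha> * q\<bar>) powr q * (LINT x:I|lebesgue. \<bar>g x\<bar> powr q)) \<and>
     (SUP (x, y) \<in> {(x, y). x \<in> I \<and> y \<in> I \<and> x \<noteq> y}.
         ereal (\<bar>f x powr ((1 - \<alpha>) / 2) - f y powr ((1 - \<alpha>) / 2)\<bar> / \<bar>x - y\<bar> powr (1 - 1 / (2 * q))))
       \<le> ereal (A * (LINT x:I|lebesgue. \<bar>g x\<bar> powr q) powr (1 / (2 * q))) \<and>
     (\<alpha> < 1 \<longrightarrow>
       (\<exists>f0. (f \<longlongrightarrow> f0) (at_right 0) \<and>
         (\<forall>x\<in>I. \<bar>f x\<bar> \<le> (f0 powr ((1 - \<alpha>) / 2)
            + A * \<bar>x\<bar> powr (1 - 1 / (2 * q)) * (LINT t:I|lebesgue. \<bar>g t\<bar> powr q) powr (1 / (2 * q)))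
              powr (2 / (1 - \<alpha>)))))"
proof -
  define p where "p = deriv f"
  define c where "c = q * (\<alpha> + 1) - 1"
  define u where "u x = \<bar>p x\<bar> powr (2 * q) * f x powr (- q * (\<alpha> + 1))" for x
  define \<Phi> where "\<Phi> x = \<kappa> * \<bar>p x\<bar> powr (2 * q - 2) * p x * f x powr (- q * (\<alpha> + 1) + 1)" for x
  define G0 where "G0 = (LINT x:I|lebesgue. \<bar>g x\<bar> powr q)"
  define B where "B = ((2 * q - 1) / \<bar>c\<bar>) powr q * G0"
  define \<beta> where "\<beta> = (1 - \<alpha>) / 2"
  define s where "s = 1 - 1 / (2 * q)"
  have q0: "q > 0" using q by simp
  have c_div: "\<alpha> + 1 - 1 / q = c / q" using q0 by (simp add: c_def field_simps)
  have c0: "c \<noteq> 0" using \<alpha>(2) c_div q0 by auto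
  have \<kappa>c: "\<kappa> = - sgn c" unfolding \<kappa> c_div using q0 by (simp add: sgn_divide)
  have c_abs: "\<bar>q - 1 + \<alpha> * q\<bar> = \<bar>c\<bar>" by (simp add: c_def algebra_simps)
  have fd: "(f has_real_derivative p x) (at x)" if "x \<in> I" for x
    using f that by (simp add: W21_loc_def p_def DERIV_deriv_iff_field_differentiable)
  have pcont: "continuous_on I p" using f by (simp add: W21_loc_def p_def)
  have sub: "{x..y} \<subseteq> I" if "x \<in> I" "y \<in> I" for x y
    using that unfolding I by (rule atLeastAtMost_subset_einterval)
  have pac: "abs_continuous_on {x..y} p" if "x \<in> I" "y \<in> I" for x y
    using f sub[OF that] by (simp add: W21_loc_def locally_abs_continuous_on_def p_def)
  have fcont: "continuous_on I f"
    by (intro continuous_at_imp_continuous_on ballI DERIV_isCont[OF fd])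
  have fpcont: "continuous_on I (\<lambda>x. f x powr t)" for t
    using f_pos by (intro continuous_on_powr fcont continuous_on_const) force
  have ucont: "continuous_on I u"
    unfolding u_def[abs_def] using q
    by (intro continuous_on_mult fpcont continuous_on_powr' continuous_intros pcont) auto
  have u0: "0 \<le> u x" for x by (simp add: u_def)
  have uint: "u integrable_on {x..y}" if "x \<in> I" "y \<in> I" for x y
    by (rule integrable_continuous_real) (rule continuous_on_subset[OF ucont sub[OF that]])
  have gint: "set_integrable lebesgue I (\<lambda>x. \<bar>g x\<bar> powr q)" using g by (simp add: in_Lq_def)
  have gI: "(\<lambda>x. \<bar>g x\<bar> powr q) integrable_on I" "G0 = integral I (\<lambda>x. \<bar>g x\<bar> powr q)"
    unfolding G0_def using set_lebesgue_integral_eq_integral[OF gint] by auto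
  have G0: "0 \<le> G0" unfolding gI(2) by (rule integral_nonneg[OF gI(1)]) simp
  have gsub: "(\<lambda>x. \<bar>g x\<bar> powr q) integrable_on {x..y}" "integral {x..y} (\<lambda>x. \<bar>g x\<bar> powr q) \<le> G0"
    if "x \<in> I" "y \<in> I" for x y
  proof -
    have "set_integrable lebesgue {x..y} (\<lambda>x. \<bar>g x\<bar> powr q)"
      by (rule set_integrable_subset[OF gint _ sub[OF that]]) simp
    then show 1: "(\<lambda>x. \<bar>g x\<bar> powr q) integrable_on {x..y}"
      by (rule set_lebesgue_integral_eq_integral(1))
    show "integral {x..y} (\<lambda>x. \<bar>g x\<bar> powr q) \<le> G0"
      unfolding gI(2) by (rule integral_subset_le[OF sub[OF that] 1 gI(1)]) simp
  qed
  have B0: "0 \<le> B" using G0 by (simp add: B_def)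
  obtain N where N: "{x \<in> space lebesgue. \<not> (x \<in> I \<longrightarrow> (p has_real_derivative g x * f x powr \<alpha>) (at x))} \<subseteq> N"
      "N \<in> null_sets lebesgue"
    using ode unfolding p_def eventually_ae_filter by blast
  have Nneg: "negligible N" using N(2) by (simp add: negligible_iff_null_sets)
  have odeN: "(p has_real_derivative g x * f x powr \<alpha>) (at x)" if "x \<in> I" "x \<notin> N" for x
    using that N(1) by auto
  have bnd: "liminf_left b \<Phi> - limsup_right 0 \<Phi> \<le> 0"
    using boundary by (simp only: \<Phi>_def[abs_def] p_def)
  have ubound: "integral {x..y} u \<le> B" if xy: "x \<in> I" "y \<in> I" "x < y" for x y
  proof (cases "integral {x..y} u = 0")
    case True
    then show ?thesis using B0 by simp
  next
    case False
    have v0: "0 \<le> integral {x..y} u" by (rule integral_nonneg[OF uint[OF xy(1,2)]]) (rule u0)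
    show ?thesis unfolding B_def
    proof (rule self_improving_bound[OF _ _ G0 v0 q])
      show "0 < \<bar>c\<bar>" using c0 by simp
      show "0 \<le> 2 * q - 1" using q by simp
      fix e :: real assume e: "e > 0"
      have "0 < x" "ereal y < b" using xy by (auto simp: I einterval_iff)
      \<comment> \<open>The interval is enlarged until the boundary terms contribute at most \<open>e\<close>.\<close>
      from boundary_increment_small[OF bnd this e] obtain r R
        where rR: "0 < r" "r \<le> x" "y \<le> R" "ereal R < b" "\<Phi> R - \<Phi> r \<le> e" by blast
      have "0 < R" using rR(1-3) xy(3) by simp
      moreover have "ereal r < b"
        by (rule le_less_trans[OF _ rR(4)]) (use rR(2,3) xy(3) in simp)
      ultimately have mem: "r \<in> I" "R \<in> I" using rR(1,4)
        by (auto simp: I einterval_iff)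
      define V where "V = integral {r..R} u"
      have vV: "integral {x..y} u \<le> V" unfolding V_def using rR xy
        by (intro integral_subset_le uint mem) (auto simp: u0)
      have Vpos: "0 < V" using vV v0 False by simp
      have "\<bar>c\<bar> * V \<le> \<Phi> R - \<Phi> r + (2 * q - 1) * (G0 + e) powr (1 / q) * V powr (1 - 1 / q)"
        unfolding V_def \<Phi>_def \<kappa>c u_def
      proof (rule weighted_energy_increment[OF q c_def _ fd _ continuous_on_subset[OF pcont] pac[OF mem] Nneg odeN gsub(1)[OF mem]])
        show "r \<le> R" using rR xy(3) by simp
        show "integral {r..R} (\<lambda>x. \<bar>g x\<bar> powr q) \<le> G0 + e" using gsub(2)[OF mem] e by simp
        show "0 < G0 + e" using G0 e by simp
        show "0 < integral {r..R} (\<lambda>x. \<bar>p x\<bar> powr (2 * q) * f x powr (- q * (\<alpha> + 1)))"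
          using Vpos by (simp add: V_def u_def[abs_def])
      qed (use sub[OF mem] f_pos in auto)
      then show "\<exists>V\<ge>integral {x..y} u. \<bar>c\<bar> * V \<le> e + (2 * q - 1) * (G0 + e) powr (1 / q) * V powr (1 - 1 / q)"
        using vV rR(5) by (intro exI[of _ V]) auto
    qed
  qed
  have uabs: "\<bar>p x\<bar> powr (2 * q) * \<bar>f x\<bar> powr (- q * (\<alpha> + 1)) = u x" if "x \<in> I" for x
    using f_pos[rule_format, OF that] by (simp add: u_def)
  have usI: "set_integrable lebesgue I u" "(LINT x:I|lebesgue. u x) \<le> B"
    using set_integrable_einterval_nonneg_bounded[OF b, of u B] ucont u0 ubound by (auto simp: I)
  have part1: "set_integrable lebesgue I (\<lambda>x. \<bar>p x\<bar> powr (2 * q) * \<bar>f x\<bar> powr (- q * (\<alpha> + 1)))"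
    "(LINT x:I|lebesgue. \<bar>p x\<bar> powr (2 * q) * \<bar>f x\<bar> powr (- q * (\<alpha> + 1))) \<le> B"
  proof -
    have eq: "(\<lambda>x. indicator I x *\<^sub>R (\<bar>p x\<bar> powr (2 * q) * \<bar>f x\<bar> powr (- q * (\<alpha> + 1)))) = (\<lambda>x. indicator I x *\<^sub>R u x)"
      by (rule ext) (use uabs in \<open>auto simp: indicator_def\<close>)
    show "set_integrable lebesgue I (\<lambda>x. \<bar>p x\<bar> powr (2 * q) * \<bar>f x\<bar> powr (- q * (\<alpha> + 1)))"
      using usI(1) unfolding set_integrable_def eq .
    show "(LINT x:I|lebesgue. \<bar>p x\<bar> powr (2 * q) * \<bar>f x\<bar> powr (- q * (\<alpha> + 1))) \<le> B"
      using usI(2) unfolding set_lebesgue_integral_def eq .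
  qed
  define E where "E = A * G0 powr (1 / (2 * q))"
  have E_eq: "E = \<bar>\<beta>\<bar> * B powr (1 / (2 * q))"
  proof -
    have "B powr (1 / (2 * q)) = ((2 * q - 1) / \<bar>c\<bar>) powr (1 / 2) * G0 powr (1 / (2 * q))"
      unfolding B_def using q G0 by (subst powr_mult) (auto simp: powr_powr)
    also have "((2 * q - 1) / \<bar>c\<bar>) powr (1 / 2) = sqrt (2 * q - 1) * \<bar>c\<bar> powr (- 1 / 2)"
      using q c0 by (subst powr_divide) (auto simp: powr_half_sqrt powr_minus_divide)
    finally show ?thesis by (simp add: E_def A c_abs \<beta>_def)
  qed
  have E0: "0 \<le> E" using B0 by (simp add: E_eq)
  have holder_less: "\<bar>f y powr \<beta> - f x powr \<beta>\<bar> \<le> E * (y - x) powr s" if xy: "x \<in> I" "y \<in> I" "x < y" for x y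
    unfolding E_eq s_def
  proof (rule Hoelder_increment_bound[where u = u])
    show "x < y" by fact
    fix t assume "t \<in> {x..y}"
    then have t: "t \<in> I" using sub[OF xy(1,2)] by blast
    then have ft: "0 < f t" using f_pos by blast
    show "((\<lambda>x. f x powr \<beta>) has_real_derivative \<beta> * f t powr (\<beta> - 1) * p t) (at t)"
      by (rule DERIV_chain2[OF has_real_derivative_powr[OF ft] fd[OF t]])
    have "u t powr (1 / (2 * q)) = \<bar>p t\<bar> powr (2 * q * (1 / (2 * q))) * f t powr (- q * (\<alpha> + 1) * (1 / (2 * q)))"
      by (simp add: u_def powr_mult powr_powr)
    also have "2 * q * (1 / (2 * q)) = 1" using q0 by simp
    also have "- q * (\<alpha> + 1) * (1 / (2 * q)) = \<beta> - 1" using q0 by (simp add: \<beta>_def field_simps)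
    finally show "\<bar>\<beta> * f t powr (\<beta> - 1) * p t\<bar> \<le> \<bar>\<beta>\<bar> * u t powr (1 / (2 * q))"
      by (simp add: abs_mult)
    show "0 \<le> u t" by (rule u0)
  next
    show "u integrable_on {x..y}" by (rule uint[OF xy(1,2)])
    show "integral {x..y} u \<le> B" by (rule ubound[OF xy])
  qed (use q B0 in auto)
  have holder: "\<bar>f x powr \<beta> - f y powr \<beta>\<bar> \<le> E * \<bar>x - y\<bar> powr s" if xy: "x \<in> I" "y \<in> I" for x y
  proof (cases x y rule: linorder_cases)
    case less
    then show ?thesis using holder_less[OF xy less] by (simp add: abs_minus_commute)
  next
    case greater
    then show ?thesis using holder_less[OF xy(2,1) greater] by simp
  qed simp
  have part2: "(SUP (x, y) \<in> {(x, y). x \<in> I \<and> y \<in> I \<and> x \<noteq> y}.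
         ereal (\<bar>f x powr \<beta> - f y powr \<beta>\<bar> / \<bar>x - y\<bar> powr s)) \<le> ereal E"
  proof (rule SUP_least, clarify)
    fix x y assume "x \<in> I" "y \<in> I" "x \<noteq> y"
    then show "ereal (\<bar>f x powr \<beta> - f y powr \<beta>\<bar> / \<bar>x - y\<bar> powr s) \<le> ereal E"
      using holder[of x y] by (simp add: divide_le_eq)
  qed
  have part3: "\<exists>f0. (f \<longlongrightarrow> f0) (at_right 0) \<and>
      (\<forall>x\<in>I. \<bar>f x\<bar> \<le> (f0 powr \<beta> + E * \<bar>x\<bar> powr s) powr (1 / \<beta>))" if \<alpha>1: "\<alpha> < 1"
  proof -
    have \<beta>0: "\<beta> > 0" using \<alpha>1 by (simp add: \<beta>_def)
    have s0: "s > 0" using q by (simp add: s_def)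
    obtain l where l: "((\<lambda>x. f x powr \<beta>) \<longlongrightarrow> l) (at_right 0)"
      and lE: "\<And>x. x \<in> I \<Longrightarrow> f x powr \<beta> \<le> l + E * \<bar>x\<bar> powr s"
      and evI: "\<forall>\<^sub>F x in at_right 0. x \<in> I"
      using Hoelder_extends_to_left_endpoint[OF b s0, of "\<lambda>x. f x powr \<beta>" E] holder by (auto simp: I)
    have l0: "0 \<le> l" by (rule tendsto_lowerbound[OF l]) auto
    have "((\<lambda>x. (f x powr \<beta>) powr (1 / \<beta>)) \<longlongrightarrow> l powr (1 / \<beta>)) (at_right 0)"
      using \<beta>0 by (intro tendsto_powr' l tendsto_const) auto
    moreover have "\<forall>\<^sub>F x in at_right 0. (f x powr \<beta>) powr (1 / \<beta>) = f x"
      using evI by eventually_elim (use \<beta>0 f_pos in \<open>force simp: powr_powr\<close>)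
    ultimately have flim: "(f \<longlongrightarrow> l powr (1 / \<beta>)) (at_right 0)"
      by (rule Lim_transform_eventually)
    note lE
    moreover have "(l powr (1 / \<beta>)) powr \<beta> = l" using l0 \<beta>0 by (simp add: powr_powr)
    moreover have "\<bar>f x\<bar> = (f x powr \<beta>) powr (1 / \<beta>)" if "x \<in> I" for x
      using f_pos[rule_format, OF that] \<beta>0 by (simp add: powr_powr)
    ultimately have "\<forall>x\<in>I. \<bar>f x\<bar> \<le> ((l powr (1 / \<beta>)) powr \<beta> + E * \<bar>x\<bar> powr s) powr (1 / \<beta>)"
      using \<beta>0 by (auto intro!: powr_mono2)
    with flim show ?thesis by blast
  qed
  have \<beta>inv: "2 / (1 - \<alpha>) = 1 / \<beta>" by (simp add: \<beta>_def)
  show ?thesis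
    unfolding p_def[symmetric] G0_def[symmetric] c_abs B_def[symmetric] \<beta>_def[symmetric] s_def[symmetric]
      \<beta>inv E_def[symmetric]
    using part1 part2 part3 by (simp add: E_def mult_ac)
qed

end
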